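(* Let $A$ be the $n\times n$ adjacency matrix of an undirected simple graph, let $3\le k\le n$, and let $m=(m_1,\dots,m_k)^{\mathsf T}\in\mathbb{N}^k$ with $m_i\ge 1$ for all $i$ and $\sum_{i=1}^k m_i=n$. Let $1\le r\le k-2$. If $$\min_{P\in\Pi_n}\ \frac12\,\big\langle P^{\mathsf T}AP,\ \overline{X}B_{r,k}\overline{X}^{\mathsf T}\big\rangle>0,$$ then $$\mathrm{bdw}(A)>\min\{m_2+\cdots+m_{r+1},\ m_3+\cdots+m_{r+2},\ \dots,\ m_{k-r}+\cdots+m_{k-1}\}.$$
   Context: $\Pi_n$ is the set of $n\times n$ permutation matrices and $\langle\cdot,\cdot\rangle$ is the trace inner product $\langle M,N\rangle=\mathrm{trace}(M^{\mathsf T}N)$. Bandwidth: for an undirected simple graph $G=(V,E)$ with $|V|=n$ and adjacency matrix $A$, a labeling is a bijection $\phi:V\to\{1,\dots,n\}$, and $\mathrm{bdw}(A)=\mathrm{bdw}(G)=\min_{\phi}\max_{[i,j]\in E}|\phi(i)-\phi(j)|$, the minimum being over all labelings $\phi$. $B_{r,k}=(b_{ij})$ is the symmetric $k\times k$ $0$–$1$ matrix with $b_{ij}=1$ if $|i-j|>r$ and $b_{ij}=0$ if $|i-j|\le r$. $\overline X\in\{0,1\}^{n\times k}$ is the basic partition matrix for $m$: $\overline X_{ij}=1$ if and only if $m_1+\cdots+m_{j-1}<i\le m_1+\cdots+m_j$ (the first $m_1$ vertices are assigned to block 1, the next $m_2$ vertices to block 2, and so on). The minimum in the conclusion is over the $k-r-1$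 sums $m_{j+1}+\cdots+m_{j+r}$, $j=1,\dots,k-r-1$. *)

theory Defs
  imports Complex_Main "Jordan_Normal_Form.Matrix"
begin

definition simple_graph :: "'a set \<Rightarrow> 'a set set \<Rightarrow> bool" where
  "simple_graph V E \<longleftrightarrow> finite V \<and> (\<forall>e\<in>E. e \<subseteq> V \<and> card e = 2)"

(* The vertices are listed in an arbitrary order v 0, ..., v (n - 1), where n = card V. *)
definition is_adjacency_mat :: "'a set \<Rightarrow> 'a set set \<Rightarrow> real mat \<Rightarrow> bool" where
  "is_adjacency_mat V E A \<longleftrightarrow>
    (\<exists>v. bij_betw v {0..<card V} V \<and>
         A = mat (card V) (card V) (\<lambda>(i, j). if {v i, v j} \<in> E then 1 else 0))"

(* The inserted 0 only matters for a graph without edges, whose bandwidth is 0. *)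
definition labeling_width :: "'a set set \<Rightarrow> ('a \<Rightarrow> nat) \<Rightarrow> nat" where
  "labeling_width E \<phi> =
    Max (insert 0 {nat \<bar>int (\<phi> u) - int (\<phi> w)\<bar> | u w. {u, w} \<in> E})"

(* A labeling is arbitrary outside V, but in a simple graph the widths are bounded by card V,
   so that Min ranges over a finite set. *)
definition bandwidth :: "'a set \<Rightarrow> 'a set set \<Rightarrow> nat" where
  "bandwidth V E = Min (labeling_width E ` {\<phi>. bij_betw \<phi> V {1..card V}})"

definition permutation_mats :: "nat \<Rightarrow> real mat set" where
  "permutation_mats n =
    {P \<in> carrier_mat n n.
       (\<forall>i<n. \<forall>j<n. P $$ (i, j) \<in> {0, 1}) \<and>
       (\<forall>i<n. \<exists>!j. j < n \<and> P $$ (i, j) = 1) \<and>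
       (\<forall>j<n. \<exists>!i. i < n \<and> P $$ (i, j) = 1)}"

definition mat_trace :: "real mat \<Rightarrow> real" where
  "mat_trace M = (\<Sum>i<dim_row M. M $$ (i, i))"

definition trace_inner :: "real mat \<Rightarrow> real mat \<Rightarrow> real" where
  "trace_inner M N = mat_trace (transpose_mat M * N)"

definition band_mat :: "nat \<Rightarrow> nat \<Rightarrow> real mat" where
  "band_mat r k = mat k k (\<lambda>(i, j). if \<bar>int i - int j\<bar> > int r then 1 else 0)"

(* The block sizes are m 1, ..., m k, whereas matrix indices start at 0: row i stands for
   vertex i + 1 and column j for block j + 1. *)
definition basic_partition_mat :: "nat \<Rightarrow> nat \<Rightarrow> (nat \<Rightarrow> nat) \<Rightarrow> real mat" where
  "basic_partition_mat n k m =
    mat n k (\<lambda>(i, j). if (\<Sum>l=1..j. m l) < i + 1 \<and> i + 1 \<le> (\<Sum>l=1..j + 1. m l)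
                        then 1 else 0)"

end

theory Submission
  imports Defs "HOL-Library.FuncSet"
begin

text \<open>An optimal labeling is a permutation matrix, so the positive minimum makes its cut value
  nonzero: some edge joins vertices whose labels lie in blocks p and q with q > p + r. All of the
  blocks p + 1, ..., p + r lie strictly between the two labels, which therefore differ by more than
  their total size.\<close>

text \<open>A nonzero sum of products has a nonzero term. This and the next two lemmas extract from
  a nonzero trace inner product the indices of the edge and of the two blocks.\<close>

lemma mult_mat_nonzero_entry:
  fixes M N :: "'b::semiring_0 mat"
  assumes "(M * N) $$ (i, j) \<noteq> 0" "i < dim_row M" "j < dim_col N" "dim_col M = dim_row N"
  shows "\<exists>l<dim_row N. M $$ (i, l) \<noteq> 0 \<and> N $$ (l, j) \<noteq> 0"
proof (rule ccontr)
  assume *: "\<not> ?thesis"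
  have "(M * N) $$ (i, j) = (\<Sum>l = 0..<dim_row N. M $$ (i, l) * N $$ (l, j))"
    using assms(2-4) by (simp add: scalar_prod_def)
  also have "\<dots> = 0"
    using * by (intro sum.neutral) auto
  finally show False
    using assms(1) by simp
qed

lemma triple_mult_mat_nonzero_entry:
  fixes L M N :: "'b::semiring_0 mat"
  assumes "(L * M * N) $$ (i, j) \<noteq> 0" "i < dim_row L" "j < dim_col N"
    and "dim_col L = dim_row M" "dim_col M = dim_row N"
  shows "\<exists>p<dim_row M. \<exists>q<dim_row N. L $$ (i, p) \<noteq> 0 \<and> M $$ (p, q) \<noteq> 0 \<and> N $$ (q, j) \<noteq> 0"
proof -
  obtain q where q: "q < dim_row N" "(L * M) $$ (i, q) \<noteq> 0" "N $$ (q, j) \<noteq> 0"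
    using mult_mat_nonzero_entry[OF assms(1)] assms(2-5) by auto
  then show ?thesis
    using mult_mat_nonzero_entry[OF q(2)] assms(2-5) by auto
qed

lemma trace_inner_nonzero_entry:
  assumes "trace_inner M N \<noteq> 0" "dim_row M = dim_row N" "dim_col M = dim_col N"
  shows "\<exists>i<dim_row N. \<exists>j<dim_col N. M $$ (i, j) \<noteq> 0 \<and> N $$ (i, j) \<noteq> 0"
proof -
  obtain j where j: "j < dim_col M" "(transpose_mat M * N) $$ (j, j) \<noteq> 0"
    using assms(1) unfolding trace_inner_def mat_trace_def
    by (auto elim!: sum.not_neutral_contains_not_neutral)
  obtain i where "i < dim_row N" "transpose_mat M $$ (j, i) \<noteq> 0" "N $$ (i, j) \<noteq> 0"
    using mult_mat_nonzero_entry[OF j(2)] j(1) assms(2,3) by auto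
  then show ?thesis
    using j(1) assms(2,3) by auto
qed

text \<open>Finiteness lets \<open>Min_le\<close> compare the minimum in the hypothesis with the
  value at one chosen matrix. A matrix is fixed by its entries inside the index range;
  \<open>restrict\<close> makes the entry function extensional, hence a member of a finite function
  space.\<close>

lemma finite_permutation_mats: "finite (permutation_mats n)"
proof -
  have "permutation_mats n \<subseteq> mat n n ` (({0..<n} \<times> {0..<n}) \<rightarrow>\<^sub>E {0, 1})"
  proof
    fix P assume P: "P \<in> permutation_mats n"
    let ?f = "restrict (\<lambda>x. P $$ x) ({0..<n} \<times> {0..<n})"
    have "P = mat n n ?f"
      using P by (intro eq_matI) (auto simp: permutation_mats_def)
    moreover have "P $$ (i, j) \<in> {0, 1}" if "i < n" "j < n" for i j
      using P that by (simp add: permutation_mats_def)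
    then have "?f \<in> ({0..<n} \<times> {0..<n}) \<rightarrow>\<^sub>E {0, 1}"
      by (simp add: PiE_iff split_paired_all)
    ultimately show "P \<in> mat n n ` (({0..<n} \<times> {0..<n}) \<rightarrow>\<^sub>E {0, 1})"
      by blast
  qed
  then show ?thesis
    by (rule finite_subset) (intro finite_imageI finite_PiE, auto)
qed

text \<open>Rows stand for positions and columns for labels, with column \<open>a\<close> for label
  \<open>a + 1\<close>. In this orientation, conjugating an adjacency matrix as
  \<open>transpose_mat P * A * P\<close> lists the vertices by label.\<close>

lemma permutation_mat_of_bij:
  assumes "bij_betw f {0..<n} {1..n}"
  shows "mat n n (\<lambda>(i, a). if f i = a + 1 then 1 else 0) \<in> permutation_mats n"
    (is "?P \<in> _")
proof -
  have entry: "a < n \<and> ?P $$ (i, a) = 1 \<longleftrightarrow> a < n \<and> f i = Suc a" if "i < n" for i a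
    using that by (auto split: if_splits)
  have entry': "i < n \<and> ?P $$ (i, a) = 1 \<longleftrightarrow> i < n \<and> f i = Suc a" if "a < n" for i a
    using that by (auto split: if_splits)
  have "\<exists>!a. a < n \<and> f i = Suc a" if "i < n" for i
  proof -
    have "f i \<in> {1..n}"
      using bij_betwE[OF assms] that by auto
    then show ?thesis
      \<comment> \<open>Labels start at 1, so the truncated subtraction is exact.\<close>
      by (intro ex1I[of _ "f i - 1"]) auto
  qed
  moreover have "\<exists>!i. i < n \<and> f i = Suc a" if "a < n" for a
  proof -
    have "Suc a \<in> f ` {0..<n}"
      using assms that by (simp add: bij_betw_def)
    then obtain i where i: "i < n" "f i = Suc a"
      by auto
    have "i' = i" if "i' < n" "f i' = Suc a" for i'
      using inj_onD[OF bij_betw_imp_inj_on[OF assms], of i' i] i that by simp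
    then show ?thesis
      using i by blast
  qed
  ultimately show ?thesis
    unfolding permutation_mats_def using entry entry' by simp
qed

text \<open>Edges lie inside the finite set \<open>V\<close>, so the widths come from pairs in
  \<open>V \<times> V\<close>. Finiteness is what makes \<open>Max\<close> in
  \<open>labeling_width\<close> an actual maximum.\<close>

lemma finite_edge_widths:
  assumes "simple_graph V E"
  shows "finite {nat \<bar>int (\<phi> u) - int (\<phi> w)\<bar> | u w. {u, w} \<in> E}"
proof (rule finite_subset)
  show "{nat \<bar>int (\<phi> u) - int (\<phi> w)\<bar> | u w. {u, w} \<in> E}
    \<subseteq> (\<lambda>(u, w). nat \<bar>int (\<phi> u) - int (\<phi> w)\<bar>) ` (V \<times> V)"
    using assms by (fastforce simp: simple_graph_def)
  show "finite ((\<lambda>(u, w). nat \<bar>int (\<phi> u) - int (\<phi> w)\<bar>) ` (V \<times> V))"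
    using assms by (simp add: simple_graph_def)
qed

lemma edge_le_labeling_width:
  assumes "simple_graph V E" "{u, w} \<in> E"
  shows "nat \<bar>int (\<phi> u) - int (\<phi> w)\<bar> \<le> labeling_width E \<phi>"
  unfolding labeling_width_def
  using finite_edge_widths[OF assms(1)] assms(2) by (intro Max_ge) auto

text \<open>This bound does not depend on the labeling, so only finitely many widths occur and the
  minimum defining \<open>bandwidth\<close> is attained.\<close>

lemma labeling_width_le_card:
  assumes "simple_graph V E" "bij_betw \<phi> V {1..card V}"
  shows "labeling_width E \<phi> \<le> card V"
proof -
  have "nat \<bar>int (\<phi> u) - int (\<phi> w)\<bar> \<le> card V" if "{u, w} \<in> E" for u w
  proof -
    have "{u, w} \<subseteq> V"
      using assms(1) that unfolding simple_graph_def by blast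
    then have "\<phi> u \<in> {1..card V}" "\<phi> w \<in> {1..card V}"
      using bij_betwE[OF assms(2)] by blast+
    then show ?thesis
      by auto
  qed
  then show ?thesis
    unfolding labeling_width_def using finite_edge_widths[OF assms(1)] by (auto simp: Max_le_iff)
qed

lemma bandwidth_attained:
  assumes "simple_graph V E"
  obtains \<phi> where "bij_betw \<phi> V {1..card V}" "bandwidth V E = labeling_width E \<phi>"
proof -
  let ?L = "{\<phi>. bij_betw \<phi> V {1..card V}}"
  have "finite V"
    using assms by (simp add: simple_graph_def)
  then have "?L \<noteq> {}"
    using finite_same_card_bij[of V "{1..card V}"] by auto
  moreover have "finite (labeling_width E ` ?L)"
    by (rule finite_subset[of _ "{..card V}"]) (auto intro: labeling_width_le_card[OF assms])
  ultimately have "bandwidth V E \<in> labeling_width E ` ?L"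
    unfolding bandwidth_def by (intro Min_in) auto
  then show ?thesis
    using that by auto
qed

text \<open>Here \<open>p\<close> and \<open>q\<close> count blocks from 0, while \<open>m\<close>
  is indexed from 1. Position \<open>a\<close> precedes the end of block \<open>m (p + 1)\<close>,
  and \<open>b\<close> is not before the start of block \<open>m (q + 1)\<close>; the window
  \<open>p + 2, ..., p + 1 + r\<close> fits between them.\<close>

lemma min_window_less_distance:
  fixes m :: "nat \<Rightarrow> nat"
  assumes "p + r < q" "q < k"
    and "a < (\<Sum>l=1..p + 1. m l)" "(\<Sum>l=1..q. m l) \<le> b"
  shows "(MIN j\<in>{1..k - r - 1}. \<Sum>i=j + 1..j + r. m i) < b - a"
proof -
  \<comment> \<open>The window index \<open>j = p + 1\<close> is admissible because
    \<open>p + r < q < k\<close> gives \<open>p + 1 \<le> k - r - 1\<close>.\<close>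
  have "(MIN j\<in>{1..k - r - 1}. \<Sum>i=j + 1..j + r. m i) \<le> (\<Sum>i=p + 1 + 1..p + 1 + r. m i)"
    using assms(1,2) by (intro Min_le finite_imageI image_eqI[where x = "p + 1"]) auto
  moreover have "(\<Sum>l=1..p + 1. m l) + (\<Sum>i=p + 1 + 1..p + 1 + r. m i) = (\<Sum>l=1..p + 1 + r. m l)"
    by (rule sum.ub_add_nat[symmetric]) simp
  moreover have "(\<Sum>l=1..p + 1 + r. m l) \<le> (\<Sum>l=1..q. m l)"
    using assms(1) by (intro sum_mono2) auto
  ultimately show ?thesis
    using assms(3,4) by linarith
qed

theorem theorem1:
  fixes V :: "'a set" and E :: "'a set set" and A :: "real mat"
    and n k r :: nat and m :: "nat \<Rightarrow> nat"
  assumes "simple_graph V E" and "card V = n" and "is_adjacency_mat V E A"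
    and "3 \<le> k" and "k \<le> n"
    and "\<And>i. i \<in> {1..k} \<Longrightarrow> 1 \<le> m i" and "(\<Sum>i=1..k. m i) = n"
    and "1 \<le> r" and "r \<le> k - 2"
    and "(MIN P\<in>permutation_mats n.
            1 / 2 * trace_inner (transpose_mat P * A * P)
              (basic_partition_mat n k m * band_mat r k * transpose_mat (basic_partition_mat n k m)))
          > 0"
  shows "bandwidth V E > (MIN j\<in>{1..k - r - 1}. \<Sum>i=j + 1..j + r. m i)"
proof -
  let ?X = "basic_partition_mat n k m"
  let ?min = "MIN j\<in>{1..k - r - 1}. \<Sum>i=j + 1..j + r. m i"
  obtain v where v: "bij_betw v {0..<n} V"
    and A: "A = mat n n (\<lambda>(i, j). if {v i, v j} \<in> E then 1 else 0)"
    using assms(2,3) unfolding is_adjacency_mat_def by blast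
  obtain \<phi> where \<phi>: "bij_betw \<phi> V {1..n}" "bandwidth V E = labeling_width E \<phi>"
    using bandwidth_attained[OF assms(1)] assms(2) by metis
  \<comment> \<open>The rows of \<open>A\<close> follow the enumeration \<open>v\<close>, so the
    label of row \<open>i\<close> is found by composing \<open>v\<close> with
    \<open>\<phi>\<close>.\<close>
  define P :: "real mat" where "P = mat n n (\<lambda>(i, a). if (\<phi> \<circ> v) i = a + 1 then 1 else 0)"
  have P: "P \<in> permutation_mats n"
    unfolding P_def using bij_betw_trans[OF v \<phi>(1)] by (rule permutation_mat_of_bij)
  have X_dims: "dim_row ?X = n" "dim_col ?X = k"
    by (simp_all add: basic_partition_mat_def)
  have B_dims: "dim_row (band_mat r k) = k" "dim_col (band_mat r k) = k"
    by (simp_all add: band_mat_def)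
  have A_dims: "dim_row A = n" "dim_col A = n"
    by (simp_all add: A)
  have P_dims: "dim_row P = n" "dim_col P = n"
    by (simp_all add: P_def)
  note dims = X_dims B_dims A_dims P_dims
  have "0 < 1 / 2 * trace_inner (transpose_mat P * A * P) (?X * band_mat r k * transpose_mat ?X)"
    by (rule less_le_trans[OF assms(10)], rule Min_le)
      (use finite_permutation_mats P in auto)
  then have "trace_inner (transpose_mat P * A * P) (?X * band_mat r k * transpose_mat ?X) \<noteq> 0"
    by auto
  from trace_inner_nonzero_entry[OF this] obtain a b where ab: "a < n" "b < n"
    and PAP: "(transpose_mat P * A * P) $$ (a, b) \<noteq> 0"
    and XBX: "(?X * band_mat r k * transpose_mat ?X) $$ (a, b) \<noteq> 0"
    by (auto simp: dims)
  obtain i j where ij: "i < n" "j < n" "P $$ (i, a) \<noteq> 0" "A $$ (i, j) \<noteq> 0" "P $$ (j, b) \<noteq> 0"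
    using triple_mult_mat_nonzero_entry[OF PAP] ab by (auto simp: dims)
  have edge: "{v i, v j} \<in> E"
    using ij by (simp add: A split: if_splits)
  have labels: "\<phi> (v i) = a + 1" "\<phi> (v j) = b + 1"
    using ij ab by (simp_all add: P_def split: if_splits)
  obtain p q where pq: "p < k" "q < k" "?X $$ (a, p) \<noteq> 0" "band_mat r k $$ (p, q) \<noteq> 0"
    "?X $$ (b, q) \<noteq> 0"
    using triple_mult_mat_nonzero_entry[OF XBX] ab by (auto simp: dims)
  have blocks: "(\<Sum>l=1..p. m l) \<le> a" "a < (\<Sum>l=1..p + 1. m l)"
    "(\<Sum>l=1..q. m l) \<le> b" "b < (\<Sum>l=1..q + 1. m l)"
    using pq ab by (auto simp: basic_partition_mat_def split: if_splits)
  \<comment> \<open>\<open>band_mat\<close> tests an absolute value, so either end of the edge may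
    have the larger label; the second case exchanges the two ends.\<close>
  have "p + r < q \<or> q + r < p"
    using pq by (auto simp: band_mat_def split: if_splits)
  then have "?min < nat \<bar>int a - int b\<bar>"
  proof
    assume "p + r < q"
    then have "?min < b - a"
      using blocks pq by (intro min_window_less_distance)
    then show ?thesis
      by linarith
  next
    assume "q + r < p"
    then have "?min < a - b"
      using blocks pq by (intro min_window_less_distance)
    then show ?thesis
      by linarith
  qed
  \<comment> \<open>The labels are \<open>a + 1\<close> and \<open>b + 1\<close>, so the shift
    cancels in their difference; \<open>\<phi>\<close> is optimal, so its width is the
    bandwidth.\<close>
  also have "\<dots> \<le> bandwidth V E"
    using edge_le_labeling_width[OF assms(1) edge, of \<phi>] by (simp add: labels \<phi>(2))
  finally show ?thesis .
qed

end
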